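(* Let $\theta>0$, $t_1=1$ and $t_k=\frac{k}{(\ln k)^\theta}$ for $k\ge2$. Suppose that Assumption $A_1$ (local error bound condition) holds, let $(x_k)$ be generated by the Inertial Forward-Backward algorithm with this $(t_k)$, and let $x_*\in X$. Then, for any constant $p\ge2$, as $k\to\infty$: 1) $F(x_k)-F(x_* )=o\left(\frac{1}{k^{2p}}\right)$ and $\|x_k-x_{k-1}\|=O\left(\frac{1}{k^p}\right)$. 2) $(x_k)$ converges (in norm) to some $\bar x\in X$, with rate $\|x_k-\bar x\|=O\left(\frac{1}{k^{p-1}}\right)$.
   Context: Setting. $H$ is a real Hilbert space; $f:H\to\mathbb{R}$ is convex and continuously differentiable with $L_f$-Lipschitz continuous gradient ($L_f>0$); $g:H\to\mathbb{R}\cup\{+\infty\}$ is proper, lower semicontinuous and convex; $F:=f+g$. It is assumed that $X:=\arg\min F\neq\emptyset$, and $F_*:=\min F=F(x_* )$ for $x_*\in X$. For $\lambda>0$, $\mathrm{prox}_{\lambda g}(z):=\arg\min_{x\in H}\{g(x)+\frac{1}{2\lambda}\|x-z\|^2\}$ and $T_\lambda(x):=\mathrm{prox}_{\lambda g}(x-\lambda\nabla f(x))$. Inertial Forward-Backward algorithm (IFB). Fix $\mu\in(0,1)$, $\lambda=\mu/L_f$, a starting point $x_0\in H$, $y_1=x_0$, and the sequence $(t_k)_{k\ge1}$ (with $t_1=1$). For $k\ge1$: $x_k=T_\lambda(y_k)$ and $y_{k+1}=x_k+\gamma_k(x_k-x_{k-1})$, where $\gamma_k=\frac{t_k-1}{t_{k+1}}$.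 Assumption $A_1$ (local error bound condition): for any $\xi\ge F_*$ there exist $\varepsilon>0$ and $\bar\tau>0$ such that $\mathrm{dist}(x,X)\le\bar\tau\,\|T_{1/L_f}(x)-x\|$ whenever $\|T_{1/L_f}(x)-x\|<\varepsilon$ and $F(x)\le\xi$. *)

theory Defs
  imports "HOL-Analysis.Analysis" "HOL-Library.Landau_Symbols"
begin

definition proper :: "('a \<Rightarrow> ereal) \<Rightarrow> bool" where
  "proper g \<longleftrightarrow> (\<forall>x. g x \<noteq> -\<infinity>) \<and> (\<exists>x. g x \<noteq> \<infinity>)"

(* The filter is punctured at x, which makes no difference to lower semicontinuity;
   at an isolated point the Liminf is infinity. *)
definition lower_semicontinuous :: "('a::topological_space \<Rightarrow> ereal) \<Rightarrow> bool" where
  "lower_semicontinuous g \<longleftrightarrow> (\<forall>x. g x \<le> Liminf (at x) g)"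

(* Counterpart of "convex_on UNIV" for extended-real-valued functions. In ereal, 0 * infinity = 0,
   so the cases u = 0 and v = 0 impose nothing; it is meant for functions that omit -infinity,
   for which the sum is unambiguous. *)
definition econvex :: "('a::real_vector \<Rightarrow> ereal) \<Rightarrow> bool" where
  "econvex g \<longleftrightarrow>
     (\<forall>x y. \<forall>u\<ge>0. \<forall>v\<ge>0. u + v = 1 \<longrightarrow>
        g (u *\<^sub>R x + v *\<^sub>R y) \<le> ereal u * g x + ereal v * g y)"

definition objective :: "('a \<Rightarrow> real) \<Rightarrow> ('a \<Rightarrow> ereal) \<Rightarrow> 'a \<Rightarrow> ereal" where
  "objective f g x = ereal (f x) + g x"

definition minimizers :: "('a \<Rightarrow> ereal) \<Rightarrow> 'a set" where
  "minimizers F = {x. is_arg_min F (\<lambda>_. True) x}"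

(* arg_min picks some minimizer; for proper, lower semicontinuous, convex g on a Hilbert space and
   lam > 0 the minimizer exists and is unique. *)
definition prox :: "('a::real_inner \<Rightarrow> ereal) \<Rightarrow> real \<Rightarrow> 'a \<Rightarrow> 'a" where
  "prox g lam z = arg_min (\<lambda>x. g x + ereal (1 / (2 * lam) * (norm (x - z))\<^sup>2)) (\<lambda>_. True)"

(* The forward-backward operator T; gradf is the gradient of the smooth part f. *)
definition fb_step :: "('a \<Rightarrow> 'a) \<Rightarrow> ('a::real_inner \<Rightarrow> ereal) \<Rightarrow> real \<Rightarrow> 'a \<Rightarrow> 'a" where
  "fb_step gradf g lam x = prox g lam (x - lam *\<^sub>R gradf x)"

definition local_error_bound ::
    "('a::real_inner \<Rightarrow> real) \<Rightarrow> ('a \<Rightarrow> 'a) \<Rightarrow> ('a \<Rightarrow> ereal) \<Rightarrow> real \<Rightarrow> bool" where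
  "local_error_bound f gradf g L \<longleftrightarrow>
     (\<forall>\<xi>::real. (INF x. objective f g x) \<le> ereal \<xi> \<longrightarrow>
        (\<exists>\<epsilon>>0. \<exists>\<tau>>0. \<forall>x.
           norm (fb_step gradf g (1 / L) x - x) < \<epsilon> \<and> objective f g x \<le> ereal \<xi> \<longrightarrow>
           infdist x (minimizers (objective f g)) \<le> \<tau> * norm (fb_step gradf g (1 / L) x - x)))"

(* x and t are used from index 0 and 1 on, respectively, and y from index 1 on; y 0 and t 0
   are irrelevant. *)
definition ifb_iterates ::
    "('a \<Rightarrow> 'a) \<Rightarrow> ('a::real_inner \<Rightarrow> ereal) \<Rightarrow> real \<Rightarrow> (nat \<Rightarrow> real) \<Rightarrow>
     (nat \<Rightarrow> 'a) \<Rightarrow> (nat \<Rightarrow> 'a) \<Rightarrow> bool" where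
  "ifb_iterates gradf g lam t x y \<longleftrightarrow>
     y 1 = x 0 \<and>
     (\<forall>k\<ge>1. x k = fb_step gradf g lam (y k) \<and>
             y (k + 1) = x k + ((t k - 1) / t (k + 1)) *\<^sub>R (x k - x (k - 1)))"

definition log_inertia :: "real \<Rightarrow> nat \<Rightarrow> real" where
  "log_inertia \<theta> k = (if k \<le> 1 then 1 else real k / (ln (real k)) powr \<theta>)"

end

theory Submission
  imports Defs "HOL-Real_Asymp.Real_Asymp"
begin

text \<open>
  Let \<open>e\<^sub>k = 2 lam (F(x\<^sub>k) - F\<^sub>*)\<close>, \<open>d\<^sub>k = |x\<^sub>k - x\<^sub>k\<^sub>-\<^sub>1|\<^sup>2\<close> and \<open>r\<^sub>k = |x\<^sub>k\<^sub>+\<^sub>1 - y\<^sub>k\<^sub>+\<^sub>1|\<^sup>2\<close>. Comparing a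
  forward-backward step with the previous iterate gives
  \<open>e\<^sub>k\<^sub>+\<^sub>1 + d\<^sub>k\<^sub>+\<^sub>1 \<le> e\<^sub>k + \<gamma>\<^sub>k\<^sup>2 d\<^sub>k - (1 - \<mu>) r\<^sub>k\<close>; hence \<open>r\<^sub>k \<longlonglongrightarrow> 0\<close>, and the local error bound
  eventually applies. Comparing the step with a nearly closest minimizer then yields
  \<open>e\<^sub>k\<^sub>+\<^sub>1 \<le> C r\<^sub>k\<close>. With \<open>c = (1 - \<mu>) / C\<close>, the quantity \<open>V\<^sub>k = (1 + c) e\<^sub>k + d\<^sub>k\<close> therefore satisfies
  \<open>V\<^sub>k\<^sub>+\<^sub>1 \<le> e\<^sub>k + \<gamma>\<^sub>k\<^sup>2 d\<^sub>k \<le> \<gamma>\<^sub>k\<^sup>2 V\<^sub>k\<close> as soon as \<open>\<gamma>\<^sub>k\<^sup>2 \<ge> 1 / (1 + c)\<close>. Since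
  \<open>1 - \<gamma>\<^sub>k\<close> behaves like \<open>(ln k)\<^sup>\<theta> / k\<close>, eventually \<open>\<gamma>\<^sub>k \<le> (k / (k + 1))\<^sup>q\<close> for every \<open>q\<close>, so \<open>V\<^sub>k\<close>
  decays faster than every power of \<open>1 / k\<close>.
\<close>

section \<open>Lower semicontinuity and lower bounds for convex functions\<close>

lemma lower_semicontinuous_eventually_greater:
  assumes "lower_semicontinuous g" "c < g w"
  shows "eventually (\<lambda>v. c < g v) (nhds w)"
proof -
  have "c < Liminf (at w) g"
    using assms unfolding lower_semicontinuous_def by (meson less_le_trans)
  then have "eventually (\<lambda>v. c < g v) (at w)"
    by (rule less_LiminfD)
  then show ?thesis
    unfolding eventually_at_filter by eventually_elim (use assms(2) in auto)
qed

text \<open>A real \<open>c\<close> strictly between \<open>b\<close> and \<open>g w\<close> would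
  eventually lie below \<open>g (u n)\<close> and above \<open>a n\<close>. The moving bound
  \<open>a\<close> lets continuous terms be shifted to the right-hand side before passing to the
  limit.\<close>

lemma lower_semicontinuous_sequentially:
  assumes "lower_semicontinuous g" "u \<longlonglongrightarrow> w" "a \<longlonglongrightarrow> b"
    and "eventually (\<lambda>n. g (u n) \<le> ereal (a n)) sequentially"
  shows "g w \<le> ereal b"
proof (rule ccontr)
  assume "\<not> g w \<le> ereal b"
  then obtain c where c: "ereal b < ereal c" "ereal c < g w"
    by (metis ereal_dense2 not_le)
  have "eventually (\<lambda>n. ereal c < g (u n)) sequentially"
    using lower_semicontinuous_eventually_greater[OF assms(1) c(2)] assms(2)
    unfolding filterlim_def le_filter_def eventually_filtermap by blast
  moreover have "eventually (\<lambda>n. a n < c) sequentially"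
    using assms(3) c(1) by (simp add: order_tendstoD(2))
  ultimately have "eventually (\<lambda>n. False) sequentially"
    using assms(4)
  proof eventually_elim
    case (elim n)
    then have "ereal c < ereal (a n)"
      by (metis less_le_trans)
    with elim show False by simp
  qed
  then show False by simp
qed

lemma is_arg_min_UNIV_iff:
  fixes h :: "'a \<Rightarrow> 'b::linorder"
  shows "is_arg_min h (\<lambda>_. True) w \<longleftrightarrow> (\<forall>v. h w \<le> h v)"
  by (auto simp: is_arg_min_linorder)

text \<open>Lower semicontinuity bounds \<open>g\<close> from below on a small ball around \<open>v\<close>, and convexity along
  rays extends this outwards; no separation theorem is needed.\<close>

lemma econvex_linear_lower_bound:
  fixes g :: "'a::real_inner \<Rightarrow> ereal"
  assumes "proper g" "lower_semicontinuous g" "econvex g" and b: "g v = ereal b"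
  obtains M where "M \<ge> 0" "\<And>u. ereal (b - 1 - M * norm (u - v)) \<le> g u"
proof -
  have "ereal (b - 1) < g v"
    using b by simp
  then obtain r where r: "r > 0" "\<And>u. dist u v < r \<Longrightarrow> ereal (b - 1) < g u"
    using lower_semicontinuous_eventually_greater[OF assms(2)] unfolding eventually_nhds_metric by blast
  have "ereal (b - 1 - 2 / r * norm (u - v)) \<le> g u" for u
  proof (cases "dist u v < r")
    case True
    have "ereal (b - 1 - 2 / r * norm (u - v)) \<le> ereal (b - 1)"
      using r(1) by simp
    with r(2)[OF True] show ?thesis
      by (metis less_imp_le order_trans)
  next
    case False
    then have n: "norm (u - v) \<ge> r"
      by (simp add: dist_norm)
    \<comment> \<open>Chosen so that the point \<open>w\<close> on the segment from \<open>v\<close>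
      to \<open>u\<close> has distance \<open>r / 2\<close> from \<open>v\<close>, where
      \<open>g\<close> exceeds \<open>b - 1\<close>. Convexity between \<open>v\<close> and
      \<open>u\<close> then forces a lower bound on \<open>g u\<close>.\<close>
    define s where "s = r / (2 * norm (u - v))"
    have s: "0 < s" "s < 1"
      using n r(1) less_le_trans[OF r(1) n] by (simp_all only: s_def) simp_all
    define w where "w = (1 - s) *\<^sub>R v + s *\<^sub>R u"
    have "w - v = s *\<^sub>R (u - v)"
      by (simp add: w_def algebra_simps)
    then have "dist w v = r / 2"
      using less_le_trans[OF r(1) n] r(1) by (simp add: dist_norm s_def)
    then have "ereal (b - 1) < g w"
      using r by auto
    also have "g w \<le> ereal (1 - s) * g v + ereal s * g u"
      using assms(3) s unfolding econvex_def w_def by simp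
    finally have ineq: "ereal (b - 1) < ereal ((1 - s) * b) + ereal s * g u"
      using b by simp
    show ?thesis
    proof (cases "g u")
      case (real c)
      then have "b - 1 < (1 - s) * b + s * c"
        using ineq by simp
      then have "s * (b - c) < 1"
        by (simp add: algebra_simps)
      then have "b - c < 1 / s"
        using s by (simp add: field_simps)
      also have "1 / s = 2 / r * norm (u - v)"
        using r(1) n by (simp add: s_def)
      finally show ?thesis
        using real by simp
    next
      case PInf
      then show ?thesis by simp
    next
      case MInf
      then show ?thesis using assms(1) unfolding proper_def by blast
    qed
  qed
  then show ?thesis
    using that[of "2 / r"] r(1) by simp
qed

section \<open>Existence and variational inequality of the proximal point\<close>

lemma norm_midpoint_squared:
  fixes u v z :: "'a::real_inner"
  shows "(norm ((1/2) *\<^sub>R u + (1/2) *\<^sub>R v - z))\<^sup>2 =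
    (norm (u - z))\<^sup>2 / 2 + (norm (v - z))\<^sup>2 / 2 - (norm (u - v))\<^sup>2 / 4"
  by (simp add: power2_norm_eq_inner inner_simps inner_commute add_divide_distrib
      diff_divide_distrib)

text \<open>\<open>g\<close> falls at most linearly in the distance, and the quadratic term
  dominates any linear loss.\<close>

lemma prox_objective_bounded_below:
  fixes g :: "'a::real_inner \<Rightarrow> ereal"
  assumes "proper g" "lower_semicontinuous g" "econvex g" "q > 0"
  obtains m where "\<And>u. ereal m \<le> g u + ereal (q * (norm (u - z))\<^sup>2)"
proof -
  obtain v b where b: "g v = ereal b"
    using assms(1) unfolding proper_def by (metis ereal_cases)
  obtain M where M: "M \<ge> 0" "\<And>u. ereal (b - 1 - M * norm (u - v)) \<le> g u"
    using econvex_linear_lower_bound[OF assms(1-3) b] by blast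
  \<comment> \<open>The last term is the maximum of \<open>M * s - q * s^2\<close> over real
    \<open>s\<close>, found by completing the square; \<open>M * norm (z - v)\<close> pays for
    recentring from \<open>v\<close> to \<open>z\<close>.\<close>
  define m where "m = b - 1 - M * norm (z - v) - M\<^sup>2 / (4 * q)"
  have "ereal m \<le> g u + ereal (q * (norm (u - z))\<^sup>2)" for u
  proof -
    have "norm (u - v) \<le> norm (u - z) + norm (z - v)"
      using norm_triangle_ineq[of "u - z" "z - v"] by simp
    then have "M * norm (u - v) \<le> M * norm (u - z) + M * norm (z - v)"
      using M(1) by (metis distrib_left mult_left_mono)
    moreover have "M * norm (u - z) \<le> q * (norm (u - z))\<^sup>2 + M\<^sup>2 / (4 * q)"
    proof -
      have "0 \<le> q * (norm (u - z) - M / (2 * q))\<^sup>2"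
        using assms(4) by simp
      also have "\<dots> = q * (norm (u - z))\<^sup>2 + M\<^sup>2 / (4 * q) - M * norm (u - z)"
        using assms(4) by (simp add: power2_eq_square field_simps)
      finally show ?thesis by simp
    qed
    ultimately have "m \<le> (b - 1 - M * norm (u - v)) + q * (norm (u - z))\<^sup>2"
      by (simp add: m_def)
    then have "ereal m \<le> ereal (b - 1 - M * norm (u - v)) + ereal (q * (norm (u - z))\<^sup>2)"
      by simp
    also have "\<dots> \<le> g u + ereal (q * (norm (u - z))\<^sup>2)"
      using M(2) by (rule add_right_mono)
    finally show ?thesis .
  qed
  then show ?thesis using that by blast
qed

text \<open>A minimizing sequence is Cauchy by the parallelogram law.\<close>

lemma prox_objective_attains_minimum:
  fixes g :: "'a::{real_inner, complete_space} \<Rightarrow> ereal"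
  assumes "proper g" "lower_semicontinuous g" "econvex g" "q > 0"
  shows "\<exists>w. \<forall>u. g w + ereal (q * (norm (w - z))\<^sup>2) \<le> g u + ereal (q * (norm (u - z))\<^sup>2)"
proof -
  define h where "h u = g u + ereal (q * (norm (u - z))\<^sup>2)" for u
  obtain m0 where m0: "\<And>u. ereal m0 \<le> h u"
    using prox_objective_bounded_below[OF assms] unfolding h_def by blast
  obtain v b where b: "g v = ereal b"
    using assms(1) unfolding proper_def by (metis ereal_cases)
  have "ereal m0 \<le> (INF u. h u)" "(INF u. h u) \<le> h v"
    using m0 by (auto intro: INF_greatest INF_lower)
  moreover have "h v = ereal (b + q * (norm (v - z))\<^sup>2)"
    by (simp add: h_def b)
  ultimately obtain m where m: "(INF u. h u) = ereal m"
    by (cases "INF u. h u") auto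
  have m_le: "ereal m \<le> h u" for u
    using m by (metis INF_lower UNIV_I)
  have "\<exists>u. h u < ereal (m + 1 / real (Suc n))" for n
  proof -
    have "(INF u. h u) < ereal (m + 1 / real (Suc n))"
      using m by simp
    then show ?thesis
      by (simp add: INF_less_iff)
  qed
  then obtain u where u: "\<And>n. h (u n) < ereal (m + 1 / real (Suc n))"
    by metis
  have finite: "\<exists>a. g (u n) = ereal a \<and> a + q * (norm (u n - z))\<^sup>2 < m + 1 / real (Suc n)" for n
  proof -
    have "g (u n) \<noteq> -\<infinity>"
      using assms(1) unfolding proper_def by blast
    then show ?thesis
      using u[of n] unfolding h_def by (cases "g (u n)") auto
  qed
  then obtain a where a: "\<And>n. g (u n) = ereal (a n)"
      "\<And>n. a n + q * (norm (u n - z))\<^sup>2 < m + 1 / real (Suc n)"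
    by metis
  have dist_u: "q * (norm (u i - u j))\<^sup>2 \<le> 2 * (1 / real (Suc i) + 1 / real (Suc j))" for i j
  proof -
    define w where "w = (1/2) *\<^sub>R u i + (1/2) *\<^sub>R u j"
    have "g w \<le> ereal (1/2) * g (u i) + ereal (1/2) * g (u j)"
      using assms(3) unfolding econvex_def w_def by simp
    then have gw: "g w \<le> ereal (a i / 2 + a j / 2)"
      by (simp add: a(1))
    have "ereal m \<le> g w + ereal (q * (norm (w - z))\<^sup>2)"
      using m_le[of w] unfolding h_def .
    also have "\<dots> \<le> ereal (a i / 2 + a j / 2) + ereal (q * (norm (w - z))\<^sup>2)"
      using gw by (rule add_right_mono)
    finally have "m \<le> a i / 2 + a j / 2 + q * (norm (w - z))\<^sup>2"
      by simp
    also have "\<dots> = (a i + q * (norm (u i - z))\<^sup>2) / 2 + (a j + q * (norm (u j - z))\<^sup>2) / 2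
        - q * (norm (u i - u j))\<^sup>2 / 4"
      unfolding w_def norm_midpoint_squared
      by (simp add: algebra_simps add_divide_distrib diff_divide_distrib)
    finally have "m \<le> \<dots>" .
    \<comment> \<open>\<open>A\<close> and \<open>B\<close> stand for the two objective values,
      \<open>P\<close> and \<open>P'\<close> for their excess over the infimum, and \<open>Q\<close>
      for the scaled squared distance.\<close>
    moreover have "Q \<le> 2 * (P + P')" if "m \<le> A / 2 + B / 2 - Q / 4" "A < m + P" "B < m + P'"
      for A B P P' Q :: real
      using that by (simp add: field_simps)
    ultimately show ?thesis
      using a(2)[of i] a(2)[of j] by blast
  qed
  have "Cauchy u"
  proof (rule metric_CauchyI)
    fix e :: real
    assume e: "e > 0"
    \<comment> \<open>From index \<open>N\<close> on, \<open>dist_u\<close> bounds the scaled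
      squared distance by \<open>4 / real N\<close>, which this choice puts below
      \<open>q * e^2\<close>.\<close>
    obtain N where N: "4 / (q * e\<^sup>2) < real N"
      using reals_Archimedean2 by blast
    have "dist (u i) (u j) < e" if "i \<ge> N" "j \<ge> N" for i j
    proof -
      have N0: "real N > 0"
        using N e assms(4) by (smt (verit) divide_pos_pos mult_pos_pos zero_less_power)
      have "1 / real (Suc i) \<le> 1 / real N" "1 / real (Suc j) \<le> 1 / real N"
        using that N0 by (auto intro!: divide_left_mono)
      then have "q * (norm (u i - u j))\<^sup>2 \<le> 4 / real N"
        using dist_u[of i j] by simp
      also have "4 / real N < q * e\<^sup>2"
        using N N0 e assms(4) by (simp add: field_simps)
      finally have "(norm (u i - u j))\<^sup>2 < e\<^sup>2"
        using assms(4) by simp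
      then show ?thesis
        using e by (simp add: dist_norm power_less_imp_less_base)
    qed
    then show "\<exists>N. \<forall>i\<ge>N. \<forall>j\<ge>N. dist (u i) (u j) < e"
      by blast
  qed
  then obtain w where w: "u \<longlonglongrightarrow> w"
    using Cauchy_convergent convergent_def by blast
  \<comment> \<open>The quadratic is continuous, so it moves into the real bound, and semicontinuity
    is applied to \<open>g\<close> alone.\<close>
  have "(\<lambda>n. m + 1 / real (Suc n) - q * (norm (u n - z))\<^sup>2) \<longlonglongrightarrow> m + 0 - q * (norm (w - z))\<^sup>2"
    using LIMSEQ_Suc[OF lim_1_over_n] by (intro tendsto_intros w) simp
  moreover have "g (u n) \<le> ereal (m + 1 / real (Suc n) - q * (norm (u n - z))\<^sup>2)" for n
    using a[of n] by simp
  ultimately have "g w \<le> ereal (m + 0 - q * (norm (w - z))\<^sup>2)"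
    using lower_semicontinuous_sequentially[OF assms(2) w] by (simp add: always_eventually)
  then have "h w \<le> ereal (m + 0 - q * (norm (w - z))\<^sup>2) + ereal (q * (norm (w - z))\<^sup>2)"
    unfolding h_def by (rule add_right_mono)
  then have "h w \<le> ereal m"
    by simp
  then show ?thesis
    using m_le unfolding h_def by (meson order_trans)
qed

text \<open>\<open>arg_min\<close> is a choice operator, so it obeys the minimality inequality only
  because a minimizer exists.\<close>

lemma prox_minimizes:
  fixes g :: "'a::{real_inner, complete_space} \<Rightarrow> ereal"
  assumes "proper g" "lower_semicontinuous g" "econvex g" "lam > 0"
  shows "g (prox g lam z) + ereal (1 / (2 * lam) * (norm (prox g lam z - z))\<^sup>2)
    \<le> g u + ereal (1 / (2 * lam) * (norm (u - z))\<^sup>2)"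
proof -
  let ?h = "\<lambda>x. g x + ereal (1 / (2 * lam) * (norm (x - z))\<^sup>2)"
  have "\<exists>w. is_arg_min ?h (\<lambda>_. True) w"
    unfolding is_arg_min_UNIV_iff
    using prox_objective_attains_minimum[OF assms(1-3), of "1 / (2 * lam)"] assms(4) by simp
  then have "is_arg_min ?h (\<lambda>_. True) (prox g lam z)"
    unfolding prox_def arg_min_def by (rule someI_ex)
  then show ?thesis
    unfolding is_arg_min_UNIV_iff by blast
qed

lemma prox_finite:
  fixes g :: "'a::{real_inner, complete_space} \<Rightarrow> ereal"
  assumes "proper g" "lower_semicontinuous g" "econvex g" "lam > 0"
  obtains c where "g (prox g lam z) = ereal c"
proof -
  obtain v b where b: "g v = ereal b"
    using assms(1) unfolding proper_def by (metis ereal_cases)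
  have "g (prox g lam z) \<noteq> \<infinity>"
    using prox_minimizes[OF assms, of z v] by (auto simp: b)
  moreover have "g (prox g lam z) \<noteq> -\<infinity>"
    using assms(1) unfolding proper_def by blast
  ultimately show ?thesis
    using that by (cases "g (prox g lam z)") auto
qed

text \<open>This is the optimality condition that \<open>(z - p) / lam\<close> is a subgradient of
  \<open>g\<close> at the proximal point \<open>p\<close>, multiplied through by \<open>lam\<close>.
  It comes from comparing \<open>p\<close> with points of the segment towards \<open>u\<close> that
  approach \<open>p\<close>.\<close>

lemma prox_subgradient:
  fixes g :: "'a::{real_inner, complete_space} \<Rightarrow> ereal"
  assumes "proper g" "lower_semicontinuous g" "econvex g" "lam > 0"
    and c: "g (prox g lam z) = ereal c" and b: "g u = ereal b"
  shows "lam * c \<le> lam * b + inner (z - prox g lam z) (prox g lam z - u)"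
proof -
  let ?p = "prox g lam z"
  \<comment> \<open>Minimality against the point at parameter \<open>s\<close>, expanded and divided
    by \<open>2 * s\<close>; the remaining quadratic term vanishes as \<open>s\<close> tends to 0
    from the right.\<close>
  have small: "lam * (c - b) \<le> inner (?p - z) (u - ?p) + s / 2 * (norm (u - ?p))\<^sup>2"
    if s: "0 < s" "s < 1" for s
  proof -
    define w where "w = (1 - s) *\<^sub>R ?p + s *\<^sub>R u"
    have "g w \<le> ereal (1 - s) * g ?p + ereal s * g u"
      using assms(3) s unfolding econvex_def w_def by simp
    then have gw: "g w \<le> ereal ((1 - s) * c + s * b)"
      by (simp add: b c)
    have "g ?p + ereal (1 / (2 * lam) * (norm (?p - z))\<^sup>2)
        \<le> g w + ereal (1 / (2 * lam) * (norm (w - z))\<^sup>2)"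
      by (rule prox_minimizes[OF assms(1-4)])
    also have "\<dots> \<le> ereal ((1 - s) * c + s * b) + ereal (1 / (2 * lam) * (norm (w - z))\<^sup>2)"
      using gw by (rule add_right_mono)
    finally have "c + 1 / (2 * lam) * (norm (?p - z))\<^sup>2
        \<le> (1 - s) * c + s * b + 1 / (2 * lam) * (norm (w - z))\<^sup>2"
      by (simp add: c)
    then have "2 * lam * (c + 1 / (2 * lam) * (norm (?p - z))\<^sup>2)
        \<le> 2 * lam * ((1 - s) * c + s * b + 1 / (2 * lam) * (norm (w - z))\<^sup>2)"
      using assms(4) by (intro mult_left_mono) auto
    then have "2 * lam * s * (c - b) \<le> (norm (w - z))\<^sup>2 - (norm (?p - z))\<^sup>2"
      using assms(4) by (simp add: distrib_left) (simp add: algebra_simps)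
    also have "w - z = (?p - z) + s *\<^sub>R (u - ?p)"
      by (simp add: w_def algebra_simps)
    also have "(norm ((?p - z) + s *\<^sub>R (u - ?p)))\<^sup>2 - (norm (?p - z))\<^sup>2
        = s * (2 * inner (?p - z) (u - ?p) + s * (norm (u - ?p))\<^sup>2)"
      by (simp only: power2_norm_eq_inner inner_simps)
        (simp add: inner_commute algebra_simps)
    finally have "s * (2 * (lam * (c - b))) \<le> s * (2 * inner (?p - z) (u - ?p) + s * (norm (u - ?p))\<^sup>2)"
      by (simp add: algebra_simps)
    then show ?thesis
      using s by simp
  qed
  have "((\<lambda>s. inner (?p - z) (u - ?p) + s / 2 * (norm (u - ?p))\<^sup>2)
      \<longlongrightarrow> inner (?p - z) (u - ?p) + 0 / 2 * (norm (u - ?p))\<^sup>2) (at_right 0)"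
    by (intro tendsto_intros) simp
  moreover have "eventually (\<lambda>s. lam * (c - b) \<le> inner (?p - z) (u - ?p) + s / 2 * (norm (u - ?p))\<^sup>2)
      (at_right 0)"
    using small unfolding eventually_at_right_field by (auto intro!: exI[of _ 1])
  ultimately have "lam * (c - b) \<le> inner (?p - z) (u - ?p) + 0 / 2 * (norm (u - ?p))\<^sup>2"
    by (intro tendsto_lowerbound) auto
  then show ?thesis
    by (simp add: inner_simps algebra_simps inner_commute)
qed

section \<open>Decay and convergence of sequences\<close>

text \<open>From \<open>K\<close> on, \<open>E\<close> is nonincreasing and bounded below, so it
  converges; its consecutive differences dominate \<open>a * r k\<close> and tend to 0.\<close>

lemma decrease_imp_tendsto_zero:
  fixes E r :: "nat \<Rightarrow> real"
  assumes "a > 0" "\<And>k. k \<ge> K \<Longrightarrow> 0 \<le> E k" "\<And>k. k \<ge> K \<Longrightarrow> 0 \<le> r k"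
    and dec: "\<And>k. k \<ge> K \<Longrightarrow> E (Suc k) \<le> E k - a * r k"
  shows "r \<longlonglongrightarrow> 0" "\<And>k. k \<ge> K \<Longrightarrow> E k \<le> E K"
proof -
  have le: "E (Suc k) \<le> E k" if "k \<ge> K" for k
  proof -
    have "0 \<le> a * r k"
      using assms(1) assms(3)[OF that] by simp
    then show ?thesis using dec[OF that] by simp
  qed
  then have "decseq (\<lambda>n. E (n + K))"
    by (simp add: decseq_Suc_iff)
  moreover have "E (n + K) \<ge> 0" for n
    using assms(2) by simp
  ultimately obtain l where "(\<lambda>n. E (n + K)) \<longlonglongrightarrow> l"
    using decseq_convergent[of "\<lambda>n. E (n + K)" 0] by blast
  then have E: "E \<longlonglongrightarrow> l"
    by (rule LIMSEQ_offset)
  show "r \<longlonglongrightarrow> 0"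
  proof (rule tendsto_sandwich[where f = "\<lambda>_. 0" and h = "\<lambda>k. (E k - E (Suc k)) / a"])
    have "(\<lambda>k. (E k - E (Suc k)) / a) \<longlonglongrightarrow> (l - l) / a"
      using assms(1) by (intro tendsto_intros E LIMSEQ_Suc[OF E]) simp
    then show "(\<lambda>k. (E k - E (Suc k)) / a) \<longlonglongrightarrow> 0"
      by simp
    show "eventually (\<lambda>k. r k \<le> (E k - E (Suc k)) / a) sequentially"
      using eventually_ge_at_top[of K]
    proof eventually_elim
      case (elim k)
      then show ?case
        using dec[OF elim] assms(1) by (simp add: field_simps)
    qed
    show "eventually (\<lambda>k. 0 \<le> r k) sequentially"
      using eventually_ge_at_top[of K] by eventually_elim (rule assms(3))
  qed (rule tendsto_const)
  show "E k \<le> E K" if "k \<ge> K" for k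
    using that by (induction k rule: dec_induct) (use le in \<open>force+\<close>)
qed

text \<open>In the energy estimate only \<open>d\<close> is damped; the growth bound turns the term
  \<open>- a * r k\<close> into damping of \<open>e\<close> as well. The weighted energy
  \<open>V\<close> then contracts by the square of \<open>\<gamma> k\<close>, and
  \<open>V k * real k powr q\<close> is eventually nonincreasing.\<close>

lemma superpolynomial_decay:
  fixes e d r \<gamma> :: "nat \<Rightarrow> real"
  assumes "a > 0" "C > 0"
    and e: "eventually (\<lambda>k. 0 \<le> e k) sequentially" and d: "\<And>k. 0 \<le> d k"
    and energy: "eventually (\<lambda>k. e (Suc k) + d (Suc k) \<le> e k + (\<gamma> k)\<^sup>2 * d k - a * r k) sequentially"
    and growth: "eventually (\<lambda>k. e (Suc k) \<le> C * r k) sequentially"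
    and lim: "\<gamma> \<longlonglongrightarrow> 1"
    and \<gamma>: "\<And>q. eventually (\<lambda>k. \<gamma> k \<le> (real k / real (Suc k)) powr q) sequentially"
  obtains M where "eventually (\<lambda>k. e k + d k \<le> M / real k powr q) sequentially"
proof -
  \<comment> \<open>With this weight \<open>c * e (Suc k) \<le> a * r k\<close>, so the residual
    term absorbs the extra summand of \<open>V (Suc k)\<close>.\<close>
  define c where "c = a / C"
  have c: "c > 0"
    using assms(1,2) by (simp add: c_def)
  define V where "V k = (1 + c) * e k + d k" for k
  have lim2: "(\<lambda>k. (\<gamma> k)\<^sup>2) \<longlonglongrightarrow> 1\<^sup>2"
    by (intro tendsto_intros lim)
  have "eventually (\<lambda>k. 0 < \<gamma> k) sequentially"
    by (rule order_tendstoD(1)[OF lim]) simp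
  moreover have "eventually (\<lambda>k. 1 / (1 + c) < (\<gamma> k)\<^sup>2) sequentially"
    by (rule order_tendstoD(1)[OF lim2]) (use c in simp)
  ultimately have "eventually (\<lambda>k. V (Suc k) * real (Suc k) powr q \<le> V k * real k powr q \<and> e k \<ge> 0 \<and> k > 0) sequentially"
    \<comment> \<open>The exponent is halved because the contraction factor is the square of
      \<open>\<gamma> k\<close>.\<close>
    using e energy growth \<gamma>[of "q / 2"] eventually_gt_at_top[of 0]
  proof eventually_elim
    case (elim k)
    have "c * e (Suc k) \<le> a * r k"
      using mult_left_mono[OF elim(5), of c] c assms(2) by (simp add: c_def)
    then have "V (Suc k) \<le> e k + (\<gamma> k)\<^sup>2 * d k"
      using elim(4) by (simp add: V_def algebra_simps)
    also have "e k \<le> (\<gamma> k)\<^sup>2 * ((1 + c) * e k)"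
    proof -
      have "1 \<le> (\<gamma> k)\<^sup>2 * (1 + c)"
        using elim(2) c by (simp add: field_simps)
      then show ?thesis
        using mult_right_mono[OF _ elim(3)] by fastforce
    qed
    finally have "V (Suc k) \<le> (\<gamma> k)\<^sup>2 * V k"
      by (simp add: V_def algebra_simps)
    also have "\<dots> \<le> (real k / real (Suc k)) powr q * V k"
    proof (rule mult_right_mono)
      have "(\<gamma> k)\<^sup>2 \<le> ((real k / real (Suc k)) powr (q / 2))\<^sup>2"
        using elim(1,6) by (intro power_mono) auto
      also have "\<dots> = (real k / real (Suc k)) powr q"
        by (simp add: power2_eq_square powr_add[symmetric])
      finally show "(\<gamma> k)\<^sup>2 \<le> (real k / real (Suc k)) powr q" .
      show "0 \<le> V k"
        using elim(3) c d[of k] by (simp add: V_def)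
    qed
    also have "\<dots> * real (Suc k) powr q = V k * real k powr q"
      by (simp add: powr_divide)
    finally show ?case
      using elim by simp
  qed
  then obtain K where K: "\<And>k. k \<ge> K \<Longrightarrow> V (Suc k) * real (Suc k) powr q \<le> V k * real k powr q"
      "\<And>k. k \<ge> K \<Longrightarrow> e k \<ge> 0" "\<And>k. k \<ge> K \<Longrightarrow> k > 0"
    unfolding eventually_sequentially by blast
  have V: "V k * real k powr q \<le> V K * real K powr q" if "k \<ge> K" for k
    using that by (induction k rule: dec_induct) (use K(1) in \<open>force+\<close>)
  have "e k + d k \<le> V K * real K powr q / real k powr q" if "k \<ge> K" for k
  proof -
    have "e k + d k \<le> V k"
      using K(2)[OF that] c by (simp add: V_def algebra_simps)
    also have "\<dots> \<le> V K * real K powr q / real k powr q"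
      using V[OF that] K(3)[OF that] by (simp add: pos_le_divide_eq)
    finally show ?thesis .
  qed
  then show ?thesis
    using that unfolding eventually_sequentially by blast
qed

text \<open>Two powers of the step bound are traded for the telescoping difference
  \<open>1 / n - 1 / (n + 1)\<close>; the other \<open>q - 1\<close> powers are frozen at the
  starting index. The tail thus has order \<open>q\<close> with the same constant
  \<open>M\<close>.\<close>

lemma polynomial_steps_imp_convergent:
  fixes x :: "nat \<Rightarrow> 'a::{real_normed_vector, complete_space}"
  assumes q: "q \<ge> 1" and M: "M \<ge> 0" and K: "K \<ge> 1"
    and step: "\<And>k. k \<ge> K \<Longrightarrow> norm (x (Suc k) - x k) \<le> M / real (Suc k) powr (q + 1)"
  obtains xbar where "x \<longlonglongrightarrow> xbar" "\<And>k. k \<ge> K \<Longrightarrow> norm (x k - xbar) \<le> M / real k powr q"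
proof -
  have tail: "norm (x n - x k) \<le> M / real k powr (q - 1) * (1 / real k - 1 / real n)"
    if "k \<ge> K" "n \<ge> k" for k n
    using that(2)
  proof (induction n rule: dec_induct)
    case base
    show ?case by simp
  next
    case (step n)
    have k: "real k > 0" "real n > 0"
      using K that(1) step(1) by auto
    have "norm (x (Suc n) - x n) \<le> M / real (Suc n) powr (q + 1)"
      using assms(4) that(1) step(1) by simp
    also have "real (Suc n) powr (q + 1) = real (Suc n) powr (q - 1) * (real (Suc n) * real (Suc n))"
      using powr_add[of "real (Suc n)" "q - 1" 2] by (simp add: power2_eq_square add.commute)
    \<comment> \<open>\<open>q \<ge> 1\<close> makes the power monotone, so its base may drop from
      \<open>Suc n\<close> to \<open>k\<close>; one of the two linear factors drops to
      \<open>n\<close>.\<close>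
    also have "M / \<dots> \<le> M / (real k powr (q - 1) * (real n * real (Suc n)))"
      using k step(1) q M by (intro divide_left_mono mult_mono powr_mono2 mult_pos_pos) auto
    also have "\<dots> = M / real k powr (q - 1) * (1 / real n - 1 / real (Suc n))"
      using k by (simp add: field_simps)
    finally have "norm (x (Suc n) - x n) \<le> M / real k powr (q - 1) * (1 / real n - 1 / real (Suc n))" .
    moreover have "norm (x (Suc n) - x k) \<le> norm (x (Suc n) - x n) + norm (x n - x k)"
      using norm_triangle_ineq[of "x (Suc n) - x n" "x n - x k"] by simp
    ultimately show ?case
      using step.IH by (simp add: right_diff_distrib)
  qed
  have bound: "norm (x n - x k) \<le> M / real k powr q" if "k \<ge> K" "n \<ge> k" for k n
  proof -
    have k: "real k > 0"
      using K that(1) by simp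
    have "norm (x n - x k) \<le> M / real k powr (q - 1) * (1 / real k - 1 / real n)"
      by (rule tail[OF that])
    also have "\<dots> \<le> M / real k powr (q - 1) * (1 / real k)"
      using M by (intro mult_left_mono) auto
    also have "\<dots> = M / real k powr q"
      using k powr_add[of "real k" "q - 1" 1] by simp
    finally show ?thesis .
  qed
  have zero: "(\<lambda>k. M / real k powr q) \<longlonglongrightarrow> 0"
    using q by real_asymp
  have "Cauchy x"
  proof (rule metric_CauchyI)
    fix \<epsilon> :: real
    assume "\<epsilon> > 0"
    then have "eventually (\<lambda>k. M / real k powr q < \<epsilon> / 2 \<and> k \<ge> K) sequentially"
      using order_tendstoD(2)[OF zero, of "\<epsilon> / 2"] eventually_ge_at_top[of K] by (simp add: eventually_conj)
    then obtain N where N: "M / real N powr q < \<epsilon> / 2" "N \<ge> K"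
      unfolding eventually_sequentially by blast
    have "dist (x i) (x j) < \<epsilon>" if "i \<ge> N" "j \<ge> N" for i j
    proof -
      have "dist (x i) (x j) \<le> norm (x i - x N) + norm (x j - x N)"
        unfolding dist_norm[symmetric] by (rule dist_triangle2)
      then show ?thesis
        using bound[OF N(2) that(1)] bound[OF N(2) that(2)] N(1) by (smt (verit) field_sum_of_halves)
    qed
    then show "\<exists>N. \<forall>i\<ge>N. \<forall>j\<ge>N. dist (x i) (x j) < \<epsilon>"
      by blast
  qed
  then obtain xbar where xbar: "x \<longlonglongrightarrow> xbar"
    using Cauchy_convergent convergent_def by blast
  moreover have "norm (x k - xbar) \<le> M / real k powr q" if "k \<ge> K" for k
  proof (rule tendsto_upperbound)
    show "(\<lambda>n. norm (x k - x n)) \<longlonglongrightarrow> norm (x k - xbar)"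
      by (intro tendsto_intros xbar)
    show "eventually (\<lambda>n. norm (x k - x n) \<le> M / real k powr q) sequentially"
      using eventually_ge_at_top[of k] by eventually_elim (metis bound norm_minus_commute that)
  qed simp
  ultimately show ?thesis
    using that by blast
qed

section \<open>The forward-backward step\<close>

locale composite_problem =
  fixes f :: "'a::{real_inner, complete_space} \<Rightarrow> real"
    and gradf :: "'a \<Rightarrow> 'a"
    and g :: "'a \<Rightarrow> ereal"
    and L :: real
  assumes convex_f: "convex_on UNIV f"
    and gradient: "GDERIV f u :> gradf u"
    and L_pos: "L > 0"
    and lipschitz: "L-lipschitz_on UNIV gradf"
    and proper_g: "proper g"
    and lsc_g: "lower_semicontinuous g"
    and convex_g: "econvex g"
begin

lemma line_derivative:
  "((\<lambda>s. f (y + s *\<^sub>R d)) has_real_derivative inner (gradf (y + s *\<^sub>R d)) d) (at s)"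
proof -
  have "((\<lambda>s. y + s *\<^sub>R d) has_derivative (\<lambda>h. h *\<^sub>R d)) (at s)"
    by (auto intro!: derivative_eq_intros)
  then have "((\<lambda>s. f (y + s *\<^sub>R d)) has_derivative (\<lambda>h. inner (h *\<^sub>R d) (gradf (y + s *\<^sub>R d)))) (at s)"
    using gradient unfolding gderiv_def by (rule has_derivative_compose)
  then show ?thesis
    unfolding has_field_derivative_def by (simp add: inner_commute mult_commute_abs)
qed

text \<open>On the line through \<open>y\<close> and \<open>u\<close> this is the tangent bound for
  a convex function of one real variable.\<close>

lemma gradient_inequality: "f y + inner (gradf y) (u - y) \<le> f u"
proof -
  let ?\<phi> = "\<lambda>s. f (y + s *\<^sub>R (u - y))"
  have "convex_on UNIV ?\<phi>"
    unfolding convex_on_def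
  proof (intro conjI ballI allI impI)
    fix a b v w :: real
    assume "v \<ge> 0" "w \<ge> 0" and vw: "v + w = 1"
    moreover have "y + (v *\<^sub>R a + w *\<^sub>R b) *\<^sub>R (u - y)
        = v *\<^sub>R (y + a *\<^sub>R (u - y)) + w *\<^sub>R (y + b *\<^sub>R (u - y))"
    proof -
      have "y = v *\<^sub>R y + w *\<^sub>R y"
        using vw by (metis scaleR_add_left scaleR_one)
      then show ?thesis
        by (simp add: scaleR_add_left scaleR_add_right)
    qed
    ultimately show "?\<phi> (v *\<^sub>R a + w *\<^sub>R b) \<le> v * ?\<phi> a + w * ?\<phi> b"
      using convex_f unfolding convex_on_def by simp
  qed simp
  then have "inner (gradf (y + 0 *\<^sub>R (u - y))) (u - y) * (1 - 0) \<le> ?\<phi> 1 - ?\<phi> 0"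
    by (rule convex_on_imp_above_tangent) (use line_derivative[of y "u - y" 0] in auto)
  then show ?thesis by simp
qed

text \<open>Along the segment from \<open>y\<close> to \<open>u\<close>, subtracting the linear and
  quadratic terms from \<open>f\<close> leaves a function of nonpositive slope, by Cauchy-Schwarz
  and the Lipschitz bound.\<close>

lemma descent_inequality: "f u \<le> f y + inner (gradf y) (u - y) + L / 2 * (norm (u - y))\<^sup>2"
proof -
  define d where "d = u - y"
  let ?\<psi> = "\<lambda>s. f (y + s *\<^sub>R d) - s * inner (gradf y) d - L / 2 * (norm d)\<^sup>2 * s\<^sup>2"
  have "?\<psi> 1 \<le> ?\<psi> 0"
  proof (rule DERIV_nonpos_imp_nonincreasing[where f = ?\<psi>])
    fix s :: real
    assume s: "0 \<le> s" "s \<le> 1"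
    have "inner (gradf (y + s *\<^sub>R d) - gradf y) d \<le> norm (gradf (y + s *\<^sub>R d) - gradf y) * norm d"
      by (rule norm_cauchy_schwarz)
    also have "\<dots> \<le> (L * norm (s *\<^sub>R d)) * norm d"
      using lipschitz_onD[OF lipschitz, of "y + s *\<^sub>R d" y]
      by (intro mult_right_mono) (auto simp: dist_norm)
    also have "\<dots> = L * (norm d)\<^sup>2 * s"
      using s by (simp add: power2_eq_square)
    finally have "inner (gradf (y + s *\<^sub>R d)) d - inner (gradf y) d - L / 2 * (norm d)\<^sup>2 * (2 * s) \<le> 0"
      by (simp add: inner_diff_left)
    moreover have "(?\<psi> has_real_derivative
        inner (gradf (y + s *\<^sub>R d)) d - inner (gradf y) d - L / 2 * (norm d)\<^sup>2 * (2 * s)) (at s)"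
    proof (intro DERIV_diff line_derivative)
      show "((\<lambda>s. s * inner (gradf y) d) has_real_derivative inner (gradf y) d) (at s)"
        by (auto intro!: derivative_eq_intros)
      show "((\<lambda>s. L / 2 * (norm d)\<^sup>2 * s\<^sup>2) has_real_derivative L / 2 * (norm d)\<^sup>2 * (2 * s)) (at s)"
        by (auto intro!: derivative_eq_intros)
    qed
    ultimately show "\<exists>D. (?\<psi> has_real_derivative D) (at s) \<and> D \<le> 0"
      by blast
  qed simp
  then show ?thesis
    by (simp add: d_def)
qed

lemma fb_step_finite:
  assumes "lam > 0"
  obtains c where "g (fb_step gradf g lam y) = ereal c"
  using prox_finite[OF proper_g lsc_g convex_g assms] unfolding fb_step_def by metis

text \<open>The basic estimate of the proof, applied with \<open>u\<close> the previous iterate and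
  with \<open>u\<close> a minimizer. It adds the proximal inequality, the descent bound from
  \<open>y\<close> to \<open>x\<close> and the gradient inequality from \<open>y\<close> to
  \<open>u\<close>.\<close>

lemma fb_step_inequality:
  assumes "lam > 0" and x: "x = fb_step gradf g lam y"
    and c: "g x = ereal c" and b: "g u = ereal b"
  shows "2 * lam * (f x + c - (f u + b))
    \<le> (norm (y - u))\<^sup>2 - (norm (x - u))\<^sup>2 - (1 - lam * L) * (norm (x - y))\<^sup>2"
proof -
  have "lam * c \<le> lam * b + inner (y - lam *\<^sub>R gradf y - x) (x - u)"
    using prox_subgradient[OF proper_g lsc_g convex_g assms(1), of "y - lam *\<^sub>R gradf y" c u b] c b
    unfolding x fb_step_def by simp
  moreover have "lam * f x \<le> lam * (f u + inner (gradf y) (x - u) + L / 2 * (norm (x - y))\<^sup>2)"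
    using descent_inequality[of x y] gradient_inequality[of y u] assms(1)
    by (intro mult_left_mono) (auto simp: inner_diff_right)
  ultimately have "lam * (f x + c - (f u + b)) \<le> inner (y - x) (x - u) + lam * L / 2 * (norm (x - y))\<^sup>2"
    by (simp add: inner_diff_left algebra_simps)
  \<comment> \<open>The three-point identity; its middle term, reduced by the descent error, leaves
    the factor \<open>1 - lam * L\<close>.\<close>
  moreover have "2 * inner (y - x) (x - u) = (norm (y - u))\<^sup>2 - (norm (y - x))\<^sup>2 - (norm (x - u))\<^sup>2"
    by (simp add: power2_norm_eq_inner inner_diff_left inner_diff_right inner_commute)
  ultimately show ?thesis
    by (simp add: norm_minus_commute algebra_simps)
qed

text \<open>The error bound measures the residual at \<open>x\<close> with step
  \<open>1 / L\<close>, while the iteration controls \<open>norm (x - y)\<close> with step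
  \<open>lam\<close>. Monotonicity of the subdifferential of \<open>g\<close>, at \<open>x\<close>
  and at the next point \<open>w\<close>, links the two.\<close>

lemma fb_step_residual_le:
  assumes "lam > 0" and x: "x = fb_step gradf g lam y"
  shows "norm (fb_step gradf g (1 / L) x - x) \<le> (1 / (lam * L) + 1) * norm (x - y)"
proof -
  define w where "w = fb_step gradf g (1 / L) x"
  obtain c where c: "g x = ereal c"
    using fb_step_finite[OF assms(1)] x by metis
  have L: "1 / L > 0"
    using L_pos by simp
  obtain b where b: "g w = ereal b"
    using fb_step_finite[OF L] w_def by metis
  have "lam * c \<le> lam * b + inner (y - lam *\<^sub>R gradf y - x) (x - w)"
    using prox_subgradient[OF proper_g lsc_g convex_g assms(1), of "y - lam *\<^sub>R gradf y" c w b] c b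
    unfolding x fb_step_def by simp
  \<comment> \<open>The subgradient of \<open>g\<close> at \<open>x\<close> that the step from
    \<open>y\<close> produces. The one at \<open>w\<close> is
    \<open>L *\<^sub>R (x - w) - gradf x\<close>, and adding both inequalities cancels
    \<open>b\<close> and \<open>c\<close>.\<close>
  have 1: "c \<le> b + inner ((1 / lam) *\<^sub>R (y - x) - gradf y) (x - w)"
  proof -
    have "(1 / lam) *\<^sub>R (y - x) - gradf y = (1 / lam) *\<^sub>R (y - lam *\<^sub>R gradf y - x)"
      using assms(1) by (simp add: scaleR_diff_right)
    then have "inner ((1 / lam) *\<^sub>R (y - x) - gradf y) (x - w)
        = inner (y - lam *\<^sub>R gradf y - x) (x - w) / lam"
      by simp
    then show ?thesis
      using \<open>lam * c \<le> _\<close> assms(1) by (simp only:) (simp add: pos_le_divide_eq field_simps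
        del: inner_diff_left)
  qed
  have "1 / L * b \<le> 1 / L * c + inner (x - (1 / L) *\<^sub>R gradf x - w) (w - x)"
    using prox_subgradient[OF proper_g lsc_g convex_g L, of "x - (1 / L) *\<^sub>R gradf x" b x c] c b
    unfolding w_def fb_step_def by simp
  then have "L * (1 / L * b) \<le> L * (1 / L * c + inner (x - (1 / L) *\<^sub>R gradf x - w) (w - x))"
    using L_pos by (intro mult_left_mono) auto
  then have "b \<le> c + inner (L *\<^sub>R (x - w) - gradf x) (w - x)"
    using L_pos by (simp add: inner_diff_left distrib_left right_diff_distrib)
  with 1 have "L * inner (x - w) (x - w) \<le> inner ((1 / lam) *\<^sub>R (y - x) + (gradf x - gradf y)) (x - w)"
    by (simp add: inner_diff_left inner_diff_right inner_add_left algebra_simps)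
  also have "\<dots> \<le> norm ((1 / lam) *\<^sub>R (y - x) + (gradf x - gradf y)) * norm (x - w)"
    by (rule norm_cauchy_schwarz)
  also have "\<dots> \<le> (1 / lam * norm (x - y) + L * norm (x - y)) * norm (x - w)"
  proof (rule mult_right_mono)
    have "norm ((1 / lam) *\<^sub>R (y - x)) = 1 / lam * norm (x - y)"
      using assms(1) by (simp add: norm_minus_commute)
    moreover have "norm (gradf x - gradf y) \<le> L * norm (x - y)"
      using lipschitz_onD[OF lipschitz, of x y] by (simp add: dist_norm)
    ultimately show "norm ((1 / lam) *\<^sub>R (y - x) + (gradf x - gradf y))
        \<le> 1 / lam * norm (x - y) + L * norm (x - y)"
      by (metis add_left_mono norm_triangle_ineq order_trans)
  qed simp
  also have "\<dots> = L * ((1 / (lam * L) + 1) * norm (x - y)) * norm (x - w)"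
    using L_pos by (simp add: field_simps)
  finally have le: "norm (x - w) * norm (x - w) \<le> ((1 / (lam * L) + 1) * norm (x - y)) * norm (x - w)"
    using L_pos by (simp add: power2_norm_eq_inner[symmetric] power2_eq_square mult.assoc)
  have "norm (x - w) \<le> (1 / (lam * L) + 1) * norm (x - y)"
  proof (cases "norm (x - w) = 0")
    case True
    then show ?thesis
      using assms(1) L_pos by simp
  next
    case False
    then show ?thesis
      using mult_right_le_imp_le[OF le] by simp
  qed
  then show ?thesis
    by (simp add: w_def norm_minus_commute)
qed

lemma minimizer_finite:
  assumes "u \<in> minimizers (objective f g)"
  obtains b where "g u = ereal b"
proof -
  obtain v b where b: "g v = ereal b"
    using proper_g unfolding proper_def by (metis ereal_cases)
  have "objective f g u \<le> objective f g v"
    using assms unfolding minimizers_def is_arg_min_UNIV_iff by blast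
  then have "g u \<noteq> \<infinity>"
    by (auto simp: objective_def b)
  moreover have "g u \<noteq> -\<infinity>"
    using proper_g unfolding proper_def by blast
  ultimately show ?thesis
    using that by (cases "g u") auto
qed

text \<open>The comparison point is a minimizer near \<open>x\<close>, inserted into
  \<open>fb_step_inequality\<close>. A nearly closest one suffices, so the attainment of the distance
  is not an issue.\<close>

lemma local_error_bound_imp_value_bound:
  assumes lam: "lam > 0" and eb: "local_error_bound f gradf g L"
    and opt: "\<And>u b. g u = ereal b \<Longrightarrow> m \<le> f u + b"
    and attained: "xs \<in> minimizers (objective f g)" "objective f g xs = ereal m"
    and small: "lam * L \<le> 1"
  shows "\<exists>\<epsilon>>0. \<exists>C>0. \<forall>x y c. x = fb_step gradf g lam y \<longrightarrow> g x = ereal c \<longrightarrow> f x + c \<le> \<xi> \<longrightarrow>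
    norm (x - y) < \<epsilon> \<longrightarrow> 2 * lam * (f x + c - m) \<le> C * (norm (x - y))\<^sup>2"
\<comment> \<open>The error bound covers only levels at or above the minimum; below it no point
  satisfies the premise.\<close>
proof (cases "m \<le> \<xi>")
  case False
  then have "\<not> f x + c \<le> \<xi>" if "g x = ereal c" for x c
    using opt[OF that] by simp
  then show ?thesis
    by (intro exI[of _ 1] conjI) auto
next
  case True
  let ?X = "minimizers (objective f g)"
  have "(INF x. objective f g x) \<le> ereal \<xi>"
    using True attained(2) by (metis INF_lower UNIV_I ereal_less_eq(3) order_trans)
  then obtain \<epsilon> \<tau> where \<epsilon>: "\<epsilon> > 0" and \<tau>: "\<tau> > 0" and bound:
    "\<And>x. norm (fb_step gradf g (1 / L) x - x) < \<epsilon> \<Longrightarrow> objective f g x \<le> ereal \<xi> \<Longrightarrow>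
      infdist x ?X \<le> \<tau> * norm (fb_step gradf g (1 / L) x - x)"
    using eb unfolding local_error_bound_def by blast
  \<comment> \<open>The factor of \<open>fb_step_residual_le\<close>; the radius
    \<open>\<epsilon> / A\<close> for \<open>norm (x - y)\<close> therefore puts the residual below
    \<open>\<epsilon>\<close>.\<close>
  define A where "A = 1 / (lam * L) + 1"
  have A: "A > 0"
    using lam L_pos by (simp add: A_def add_pos_pos)
  have main: "2 * lam * (f x + c - m) \<le> (1 + 2 * (\<tau> * A + 1)) * (norm (x - y))\<^sup>2"
    if x: "x = fb_step gradf g lam y" and c: "g x = ereal c" and le: "f x + c \<le> \<xi>"
      and near: "norm (x - y) < \<epsilon> / A" for x y c
  proof -
    have res: "norm (fb_step gradf g (1 / L) x - x) \<le> A * norm (x - y)"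
      unfolding A_def by (rule fb_step_residual_le[OF lam x])
    also have "\<dots> < \<epsilon>"
      using near A by (simp add: pos_less_divide_eq mult.commute)
    finally have "infdist x ?X \<le> \<tau> * norm (fb_step gradf g (1 / L) x - x)"
      by (rule bound) (simp add: objective_def c le)
    also have "\<dots> \<le> \<tau> * (A * norm (x - y))"
      using res \<tau> by simp
    finally have inf: "infdist x ?X \<le> \<tau> * A * norm (x - y)"
      by (simp add: mult.assoc)
    have step: "2 * lam * (f x + c - m) \<le> (norm (y - u))\<^sup>2 - (norm (x - u))\<^sup>2" if u: "u \<in> ?X" for u
    proof -
      obtain b where b: "g u = ereal b"
        using minimizer_finite[OF u] by blast
      have "objective f g u = ereal m"
        using u attained unfolding minimizers_def is_arg_min_UNIV_iff mem_Collect_eq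
        by (metis antisym)
      then have "f u + b = m"
        by (simp add: objective_def b)
      moreover have "(1 - lam * L) * (norm (x - y))\<^sup>2 \<ge> 0"
        using small by simp
      ultimately show ?thesis
        using fb_step_inequality[OF lam x c b] by simp
    qed
    show ?thesis
    \<comment> \<open>For distinct points, the summand 1 in \<open>\<tau> * A + 1\<close> makes the
      distance bound strict, which yields an actual minimizer \<open>u\<close>. For
      \<open>x = y\<close> there is no such slack, but \<open>step\<close> already gives the bound
      0.\<close>
    proof (cases "x = y")
      case True
      then show ?thesis
        using step[OF attained(1)] by simp
    next
      case False
      then have "infdist x ?X < (\<tau> * A + 1) * norm (x - y)"
        using inf by (simp add: distrib_right add.commute add_strict_increasing)
      moreover have ne: "?X \<noteq> {}"
        using attained(1) by blast
      ultimately obtain u where u: "u \<in> ?X" "norm (x - u) < (\<tau> * A + 1) * norm (x - y)"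
        unfolding infdist_notempty[OF ne] using cInf_lessD[of "dist x ` ?X"]
        by (auto simp: dist_norm)
      have "norm (y - u) \<le> norm (x - y) + norm (x - u)"
        using dist_triangle3[of y u x] by (simp add: dist_norm)
      then have "(norm (y - u))\<^sup>2 \<le> (norm (x - y) + norm (x - u))\<^sup>2"
        by (simp add: power_mono)
      then have "2 * lam * (f x + c - m) \<le> (norm (x - y))\<^sup>2 + 2 * norm (x - y) * norm (x - u)"
        using step[OF u(1)] by (simp add: power2_sum)
      also have "\<dots> \<le> (norm (x - y))\<^sup>2 + 2 * norm (x - y) * ((\<tau> * A + 1) * norm (x - y))"
        using u(2) by (intro add_left_mono mult_left_mono) auto
      finally show ?thesis
        by (simp add: power2_eq_square algebra_simps)
    qed
  qed
  moreover have "\<epsilon> / A > 0"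
    using \<epsilon> A by simp
  moreover have "1 + 2 * (\<tau> * A + 1) > 0"
    using mult_pos_pos[OF \<tau> A] by simp
  ultimately show ?thesis
    by metis
qed

section \<open>Energy decay along the inertial iteration\<close>

lemma ifb_decay:
  assumes lam: "lam > 0" "lam * L < 1" and eb: "local_error_bound f gradf g L"
    and xs: "xs \<in> minimizers (objective f g)" and m: "objective f g xs = ereal m"
    and ifb: "ifb_iterates gradf g lam t x y"
  defines "\<gamma> \<equiv> \<lambda>k. (t k - 1) / t (k + 1)"
  assumes lim: "\<gamma> \<longlonglongrightarrow> 1"
    and \<gamma>: "\<And>q. eventually (\<lambda>k. \<gamma> k \<le> (real k / real (Suc k)) powr q) sequentially"
    and c: "\<And>k. k \<ge> 1 \<Longrightarrow> g (x k) = ereal (c k)"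
  obtains M where "eventually (\<lambda>k. 2 * lam * (f (x k) + c k - m) + (norm (x k - x (k - 1)))\<^sup>2
    \<le> M / real k powr q) sequentially"
proof -
  define e where "e k = 2 * lam * (f (x k) + c k - m)" for k
  define d where "d k = (norm (x k - x (k - 1)))\<^sup>2" for k
  define r where "r k = (norm (x (Suc k) - y (Suc k)))\<^sup>2" for k
  have opt: "m \<le> f u + b" if "g u = ereal b" for u b
  proof -
    have "objective f g xs \<le> objective f g u"
      using xs unfolding minimizers_def is_arg_min_UNIV_iff by blast
    then show ?thesis
      by (simp add: m) (simp add: objective_def that)
  qed
  have step: "x k = fb_step gradf g lam (y k)" "y (Suc k) = x k + \<gamma> k *\<^sub>R (x k - x (k - 1))"
    if "k \<ge> 1" for k
    using ifb that unfolding ifb_iterates_def \<gamma>_def by auto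
  have e_nonneg: "0 \<le> e k" if "k \<ge> 1" for k
    using opt[OF c[OF that]] lam by (simp add: e_def)
  \<comment> \<open>The comparison point is \<open>x k\<close>, and \<open>y (Suc k) - x k\<close>
    is the inertial displacement. The start \<open>x 0\<close> enters only through
    \<open>d 1\<close>, since \<open>g (x 0)\<close> may be infinite.\<close>
  have energy: "e (Suc k) + d (Suc k) \<le> e k + (\<gamma> k)\<^sup>2 * d k - (1 - lam * L) * r k"
    if "k \<ge> 1" for k
  proof -
    have "e (Suc k) - e k \<le> (norm (y (Suc k) - x k))\<^sup>2 - d (Suc k) - (1 - lam * L) * r k"
      using fb_step_inequality[OF lam(1) step(1) c c, of "Suc k" k] that
      by (simp add: e_def d_def r_def right_diff_distrib)
    moreover have "(norm (y (Suc k) - x k))\<^sup>2 = (\<gamma> k)\<^sup>2 * d k"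
      by (simp add: step(2)[OF that] d_def power_mult_distrib)
    ultimately show ?thesis by simp
  qed
  have "eventually (\<lambda>k. 0 < \<gamma> k) sequentially"
    by (rule order_tendstoD(1)[OF lim]) simp
  \<comment> \<open>The hypothesis on \<open>\<gamma>\<close> with exponent 0 says
    \<open>\<gamma> k \<le> 1\<close>.\<close>
  then have "eventually (\<lambda>k. (\<gamma> k)\<^sup>2 \<le> 1 \<and> 1 \<le> k) sequentially"
    using \<gamma>[of 0] eventually_ge_at_top[of 1]
    by eventually_elim (auto simp: power_le_one split: if_splits)
  then obtain K where K: "\<And>k. k \<ge> K \<Longrightarrow> (\<gamma> k)\<^sup>2 \<le> 1" "\<And>k. k \<ge> K \<Longrightarrow> 1 \<le> k"
    unfolding eventually_sequentially by blast
  have dec: "e (Suc k) + d (Suc k) \<le> (e k + d k) - (1 - lam * L) * r k" if "k \<ge> K" for k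
  proof -
    have "(\<gamma> k)\<^sup>2 * d k \<le> d k"
      using K(1)[OF that] by (simp add: d_def mult_left_le_one_le)
    then show ?thesis
      using energy[OF K(2)[OF that]] by simp
  qed
  have E: "0 \<le> e k + d k" if "k \<ge> K" for k
    using e_nonneg[OF K(2)[OF that]] by (simp add: d_def)
  have r0: "r \<longlonglongrightarrow> 0" and bounded: "\<And>k. k \<ge> K \<Longrightarrow> e k + d k \<le> e K + d K"
    using decrease_imp_tendsto_zero[where E = "\<lambda>k. e k + d k" and r = r and a = "1 - lam * L" and K = K]
      E dec lam(2) by (auto simp: r_def)
  \<comment> \<open>The energy bound \<open>e k \<le> e K + d K\<close> rewritten as a bound on the
    objective value, so all iterates from \<open>K\<close> on lie in one sublevel set.\<close>
  define \<xi> where "\<xi> = m + (e K + d K) / (2 * lam)"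
  obtain \<epsilon> C where "\<epsilon> > 0" and C: "C > 0" and bound:
    "\<And>x y c. x = fb_step gradf g lam y \<Longrightarrow> g x = ereal c \<Longrightarrow> f x + c \<le> \<xi> \<Longrightarrow>
      norm (x - y) < \<epsilon> \<Longrightarrow> 2 * lam * (f x + c - m) \<le> C * (norm (x - y))\<^sup>2"
    using local_error_bound_imp_value_bound[OF lam(1) eb opt xs m, of \<xi>] lam(2) by auto
  have "eventually (\<lambda>k. r k < \<epsilon>\<^sup>2) sequentially"
    using r0 \<open>\<epsilon> > 0\<close> by (intro order_tendstoD(2)) auto
  then have growth: "eventually (\<lambda>k. e (Suc k) \<le> C * r k) sequentially"
    using eventually_ge_at_top[of K]
  proof eventually_elim
    case (elim k)
    have "e (Suc k) \<le> e K + d K"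
      using bounded[of "Suc k"] elim zero_le_power2[of "norm (x (Suc k) - x (Suc k - 1))"]
      unfolding d_def by linarith
    then have "f (x (Suc k)) + c (Suc k) \<le> \<xi>"
      using lam(1) by (simp add: \<xi>_def e_def field_simps)
    moreover have "norm (x (Suc k) - y (Suc k)) < \<epsilon>"
      using elim(1) \<open>\<epsilon> > 0\<close> unfolding r_def by (simp add: power_less_imp_less_base)
    ultimately show ?case
      unfolding e_def r_def by (rule bound[OF step(1) c, rotated 2]) simp_all
  qed
  have "eventually (\<lambda>k. 0 \<le> e k) sequentially"
    using eventually_ge_at_top[of 1] by eventually_elim (rule e_nonneg)
  moreover have "0 \<le> d k" for k
    by (simp add: d_def)
  moreover have "eventually (\<lambda>k. e (Suc k) + d (Suc k) \<le> e k + (\<gamma> k)\<^sup>2 * d k - (1 - lam * L) * r k) sequentially"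
    using eventually_ge_at_top[of 1] by eventually_elim (rule energy)
  moreover have "1 - lam * L > 0"
    using lam(2) by simp
  ultimately obtain M where "eventually (\<lambda>k. e k + d k \<le> M / real k powr q) sequentially"
    using superpolynomial_decay[OF _ C _ _ _ growth lim \<gamma>] by blast
  then show ?thesis
    using that by (simp add: e_def d_def)
qed

end

section \<open>Asymptotics of the inertial coefficients\<close>

text \<open>The coefficient is at most \<open>R x - S x\<close>. Multiplied by \<open>x\<close>, the
  deviation of \<open>R\<close> from 1 vanishes, while \<open>S\<close> grows like
  \<open>ln x powr \<theta>\<close> and outgrows the limit \<open>q\<close> of the same expansion
  for \<open>(x / (x + 1)) powr q\<close>.\<close>

lemma log_ratio_eventually_le:
  fixes \<theta> q :: real
  assumes "\<theta> > 0"
  defines "\<gamma> \<equiv> \<lambda>x. (x / ln x powr \<theta> - 1) / ((x + 1) / ln (x + 1) powr \<theta>)"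
  shows "eventually (\<lambda>x. \<gamma> x \<le> (x / (x + 1)) powr q) at_top"
proof -
  define R where "R x = exp (\<theta> * ln (ln (x + 1) / ln x))" for x :: real
  define S where "S x = ln (x + 1) powr \<theta> / (x + 1)" for x :: real
  have "eventually (\<lambda>x. x * (R x - 1) < 1) at_top"
  proof (rule order_tendstoD(2))
    show "((\<lambda>x. x * (R x - 1)) \<longlongrightarrow> 0) at_top"
      unfolding R_def using assms(1) by real_asymp
  qed simp
  moreover have "eventually (\<lambda>x. x * S x > q + 2) at_top"
  proof -
    have "filterlim (\<lambda>x. x * S x) at_top at_top"
      unfolding S_def using assms(1) by real_asymp
    then show ?thesis
      by (simp add: filterlim_at_top_dense)
  qed
  moreover have "eventually (\<lambda>x::real. x * (1 - (x / (x + 1)) powr q) < q + 1) at_top"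
  proof (rule order_tendstoD(2))
    show "((\<lambda>x::real. x * (1 - (x / (x + 1)) powr q)) \<longlongrightarrow> q) at_top"
      by real_asymp
  qed simp
  ultimately show ?thesis
    using eventually_gt_at_top[of 1]
  proof eventually_elim
    case (elim x)
    have R: "R x = ln (x + 1) powr \<theta> / ln x powr \<theta>"
      using elim(4) by (simp add: R_def powr_def ln_div exp_diff right_diff_distrib)
    have "\<gamma> x = x / (x + 1) * R x - S x"
      using elim(4) by (simp add: \<gamma>_def R S_def left_diff_distrib diff_divide_distrib)
    also have "\<dots> \<le> R x - S x"
      using elim(4) by (simp add: R_def field_simps)
    finally have "x * \<gamma> x \<le> x * (R x - S x)"
      using elim(4) by simp
    also have "\<dots> \<le> x * (x / (x + 1)) powr q"
      using elim(1-3) by (simp add: algebra_simps)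
    finally show ?case
      using elim(4) by simp
  qed
qed

lemma log_inertia_ratio_tendsto:
  fixes \<theta> :: real
  assumes "\<theta> > 0"
  shows "(\<lambda>k. (log_inertia \<theta> k - 1) / log_inertia \<theta> (k + 1)) \<longlonglongrightarrow> 1"
proof -
  have "((\<lambda>x::real. (x / ln x powr \<theta> - 1) / ((x + 1) / ln (x + 1) powr \<theta>)) \<longlongrightarrow> 1) at_top"
    using assms by real_asymp
  then have "(\<lambda>k. (real k / ln (real k) powr \<theta> - 1) / ((real k + 1) / ln (real k + 1) powr \<theta>)) \<longlonglongrightarrow> 1"
    by (rule filterlim_compose) (rule filterlim_real_sequentially)
  then show ?thesis
    \<comment> \<open>For \<open>k > 1\<close> both \<open>k\<close> and \<open>k + 1\<close> avoid
      the special value of \<open>log_inertia\<close> at small indices.\<close>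
    by (rule Lim_transform_eventually)
      (rule eventually_mono[OF eventually_gt_at_top[of 1]], simp add: log_inertia_def add.commute)
qed

lemma log_inertia_ratio_eventually_le:
  fixes \<theta> q :: real
  assumes "\<theta> > 0"
  shows "eventually (\<lambda>k. (log_inertia \<theta> k - 1) / log_inertia \<theta> (k + 1)
    \<le> (real k / real (Suc k)) powr q) sequentially"
  using filterlim_real_sequentially[THEN filterlim_iff[THEN iffD1], rule_format,
      OF log_ratio_eventually_le[OF assms, of q]] eventually_gt_at_top[of 1]
  by eventually_elim (simp add: log_inertia_def add.commute)

section \<open>Rates for the objective values and the iterates\<close>

theorem corollary3p4:
  fixes f :: "'a::{real_inner, complete_space} \<Rightarrow> real"
    and gradf :: "'a \<Rightarrow> 'a"
    and g :: "'a \<Rightarrow> ereal"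
    and F :: "'a \<Rightarrow> ereal"
    and X :: "'a set"
    and L \<mu> \<theta> p :: real
    and x y :: "nat \<Rightarrow> 'a"
    and xs :: 'a
  defines "F \<equiv> objective f g"
    and "X \<equiv> minimizers F"
  assumes "convex_on UNIV f"
    and "\<And>u. GDERIV f u :> gradf u"
    and "L > 0"
    and "L-lipschitz_on UNIV gradf"
    and "proper g"
    and "lower_semicontinuous g"
    and "econvex g"
    and "0 < \<mu>" and "\<mu> < 1"
    and "0 < \<theta>"
    and "local_error_bound f gradf g L"
    and "ifb_iterates gradf g (\<mu> / L) (log_inertia \<theta>) x y"
    and "xs \<in> X"
    and "p \<ge> 2"
  shows "(\<forall>k\<ge>1. F (x k) \<noteq> \<infinity>)
    \<and> (\<lambda>k. real_of_ereal (F (x k) - F xs)) \<in> o(\<lambda>k. 1 / real k powr (2 * p))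
    \<and> (\<lambda>k. norm (x k - x (k - 1))) \<in> O(\<lambda>k. 1 / real k powr p)
    \<and> (\<exists>xbar\<in>X. x \<longlonglongrightarrow> xbar
          \<and> (\<lambda>k. norm (x k - xbar)) \<in> O(\<lambda>k. 1 / real k powr (p - 1)))"
proof -
  interpret composite_problem f gradf g L
    by (rule composite_problem.intro) fact+
  define lam where "lam = \<mu> / L"
  have lam: "lam > 0" "lam * L < 1"
    using \<open>0 < \<mu>\<close> \<open>\<mu> < 1\<close> \<open>L > 0\<close> by (auto simp: lam_def)
  have xs: "xs \<in> minimizers (objective f g)"
    using \<open>xs \<in> X\<close> by (simp add: X_def F_def)
  obtain b where b: "g xs = ereal b"
    using minimizer_finite[OF xs] by blast
  define m where "m = f xs + b"
  have m: "objective f g xs = ereal m"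
    by (simp add: objective_def b m_def)
  have ifb: "ifb_iterates gradf g lam (log_inertia \<theta>) x y"
    using \<open>ifb_iterates _ _ _ _ _ _\<close> by (simp add: lam_def)
  have "\<exists>a. g (x k) = ereal a" if "k \<ge> 1" for k
    using fb_step_finite[OF lam(1)] ifb that unfolding ifb_iterates_def by metis
  then obtain c where c: "\<And>k. k \<ge> 1 \<Longrightarrow> g (x k) = ereal (c k)"
    by metis
  define e where "e k = f (x k) + c k - m" for k
  have F: "F (x k) = ereal (m + e k)" if "k \<ge> 1" for k
    by (simp add: F_def objective_def c[OF that] e_def)
  have e_nonneg: "e k \<ge> 0" if "k \<ge> 1" for k
  proof -
    have "objective f g xs \<le> F (x k)"
      using xs unfolding minimizers_def is_arg_min_UNIV_iff F_def by blast
    then show ?thesis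
      by (simp add: m F[OF that])
  qed
  have decay: "\<exists>M. eventually (\<lambda>k. 2 * lam * e k + (norm (x k - x (k - 1)))\<^sup>2 \<le> M / real k powr q) sequentially"
    for q
    using ifb_decay[OF lam \<open>local_error_bound f gradf g L\<close> xs m ifb
        log_inertia_ratio_tendsto[OF \<open>0 < \<theta>\<close>] log_inertia_ratio_eventually_le[OF \<open>0 < \<theta>\<close>] c]
    unfolding e_def by blast
  have value_rate: "e \<in> O(\<lambda>k. 1 / real k powr q)" for q
  proof -
    obtain M where "eventually (\<lambda>k. 2 * lam * e k + (norm (x k - x (k - 1)))\<^sup>2 \<le> M / real k powr q) sequentially"
      using decay by blast
    then have "eventually (\<lambda>k. norm (e k) \<le> M / (2 * lam) * norm (1 / real k powr q)) sequentially"
      using eventually_ge_at_top[of 1]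
    proof eventually_elim
      case (elim k)
      have "2 * lam * e k \<le> M / real k powr q"
        using elim(1) zero_le_power2[of "norm (x k - x (k - 1))"] by linarith
      then have "2 * lam * e k / (2 * lam) \<le> M / real k powr q / (2 * lam)"
        by (rule divide_right_mono) (use lam(1) in simp)
      moreover have "norm (e k) = 2 * lam * e k / (2 * lam)"
        using e_nonneg[OF elim(2)] lam(1) by simp
      moreover have "M / real k powr q / (2 * lam) = M / (2 * lam) * norm (1 / real k powr q)"
        by simp
      ultimately show ?case
        by (simp only:)
    qed
    then show ?thesis
      by (rule bigoI)
  qed
  \<comment> \<open>Since \<open>value_rate\<close> holds for every exponent, one extra power turns
    big-O into little-o.\<close>
  have small: "(\<lambda>k. 1 / real k powr (2 * p + 1)) \<in> o(\<lambda>k. 1 / real k powr (2 * p))"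
    by real_asymp
  \<comment> \<open>Exponent \<open>2 * p\<close>, because a square root follows;
    \<open>\<bar>M\<bar>\<close> is used there since \<open>M\<close> carries no sign
    information.\<close>
  obtain M where M: "eventually (\<lambda>k. 2 * lam * e k + (norm (x k - x (k - 1)))\<^sup>2 \<le> M / real k powr (2 * p)) sequentially"
    using decay by blast
  have "eventually (\<lambda>k. norm (x k - x (k - 1)) \<le> sqrt \<bar>M\<bar> / real k powr p \<and> k \<ge> 1) sequentially"
    using M eventually_ge_at_top[of 1]
  proof eventually_elim
    case (elim k)
    have "(norm (x k - x (k - 1)))\<^sup>2 \<le> M / real k powr (2 * p)"
      using elim(1) e_nonneg[OF elim(2)] lam(1) by (smt (verit) mult_nonneg_nonneg)
    also have "\<dots> \<le> \<bar>M\<bar> / real k powr (2 * p)"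
      by (simp add: divide_right_mono)
    also have "\<dots> = (sqrt \<bar>M\<bar> / real k powr p)\<^sup>2"
      by (simp add: power_divide power2_eq_square powr_add[symmetric])
    finally have "norm (x k - x (k - 1)) \<le> sqrt \<bar>M\<bar> / real k powr p"
      by (rule power2_le_imp_le) simp
    with elim(2) show ?case
      by simp
  qed
  then obtain K where K: "\<And>k. k \<ge> K \<Longrightarrow> norm (x k - x (k - 1)) \<le> sqrt \<bar>M\<bar> / real k powr p"
      "\<And>k. k \<ge> K \<Longrightarrow> k \<ge> 1"
    unfolding eventually_sequentially by blast
  obtain xbar where xbar: "x \<longlonglongrightarrow> xbar"
      "\<And>k. k \<ge> K \<Longrightarrow> norm (x k - xbar) \<le> sqrt \<bar>M\<bar> / real k powr (p - 1)"
  \<comment> \<open>Applied with \<open>q = p - 1\<close>, which is at least 1 exactly because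
    \<open>p \<ge> 2\<close>.\<close>
  proof (rule polynomial_steps_imp_convergent)
    show "norm (x (Suc k) - x k) \<le> sqrt \<bar>M\<bar> / real (Suc k) powr (p - 1 + 1)" if "k \<ge> K" for k
      using K(1)[of "Suc k"] that by simp
  qed (use \<open>p \<ge> 2\<close> K(2)[of K] in auto)
  \<comment> \<open>The values tend to \<open>m\<close>, \<open>f\<close> is continuous and
    \<open>g\<close> is lower semicontinuous, so the value at the limit is at most
    \<open>m\<close>.\<close>
  have "xbar \<in> X"
  proof -
    have "e \<longlonglongrightarrow> 0"
    proof -
      have "(\<lambda>k. 1 / real k powr 1) \<in> o(\<lambda>_. 1)"
        by real_asymp
      then have "e \<in> o(\<lambda>_. 1)"
        by (rule landau_o.big_small_trans[OF value_rate])
      from smalloD_tendsto[OF this] show ?thesis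
        by simp
    qed
    moreover have "isCont f xbar"
      using gradient unfolding gderiv_def by (rule has_derivative_continuous)
    then have "(\<lambda>k. f (x k)) \<longlonglongrightarrow> f xbar"
      using xbar(1) by (rule isCont_tendsto_compose)
    ultimately have "(\<lambda>k. m + e k - f (x k)) \<longlonglongrightarrow> m + 0 - f xbar"
      by (intro tendsto_intros)
    moreover have "eventually (\<lambda>k. g (x k) \<le> ereal (m + e k - f (x k))) sequentially"
      using eventually_ge_at_top[of 1] by eventually_elim (simp add: c e_def)
    ultimately have "g xbar \<le> ereal (m + 0 - f xbar)"
      by (rule lower_semicontinuous_sequentially[OF lsc_g xbar(1)])
    then have "ereal (f xbar) + g xbar \<le> ereal (f xbar) + ereal (m + 0 - f xbar)"
      by (rule add_left_mono)
    then have le: "objective f g xbar \<le> objective f g xs"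
      unfolding m by (simp add: objective_def)
    have "objective f g xbar \<le> objective f g v" for v
      using le by (rule order_trans) (use xs in \<open>simp add: minimizers_def is_arg_min_UNIV_iff\<close>)
    then show ?thesis
      unfolding X_def F_def minimizers_def is_arg_min_UNIV_iff by simp
  qed
  \<comment> \<open>This excludes that \<open>real_of_ereal\<close> turns an infinite gap into 0 in
    the rate for the values.\<close>
  moreover have "\<forall>k\<ge>1. F (x k) \<noteq> \<infinity>"
    by (simp add: F)
  moreover have "(\<lambda>k. real_of_ereal (F (x k) - F xs)) \<in> o(\<lambda>k. 1 / real k powr (2 * p))"
  proof -
    have "F xs = ereal m"
      by (simp add: F_def m)
    \<comment> \<open>The equality is claimed only from index 1 on, as \<open>F (x 0)\<close> may be
      infinite.\<close>
    have "eventually (\<lambda>k. real_of_ereal (F (x k) - F xs) = e k) sequentially"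
      using eventually_ge_at_top[of 1] by eventually_elim (simp add: F \<open>F xs = ereal m\<close>)
    from landau_o.small.in_cong[OF this] landau_o.big_small_trans[OF value_rate small] show ?thesis
      by simp
  qed
  moreover have "(\<lambda>k. norm (x k - x (k - 1))) \<in> O(\<lambda>k. 1 / real k powr p)"
  proof (rule bigoI)
    show "eventually (\<lambda>k. norm (norm (x k - x (k - 1))) \<le> sqrt \<bar>M\<bar> * norm (1 / real k powr p)) sequentially"
      using eventually_ge_at_top[of K] by eventually_elim (simp add: K(1)[simplified])
  qed
  moreover have "(\<lambda>k. norm (x k - xbar)) \<in> O(\<lambda>k. 1 / real k powr (p - 1))"
  proof (rule bigoI)
    show "eventually (\<lambda>k. norm (norm (x k - xbar)) \<le> sqrt \<bar>M\<bar> * norm (1 / real k powr (p - 1))) sequentially"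
      using eventually_ge_at_top[of K] by eventually_elim (simp add: xbar(2))
  qed
  ultimately show ?thesis
    using xbar(1) by blast
qed

end
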